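(* Let $q$ be a prime power and let $n,k$ be integers. If $1\le k\le n$, then $$\mathcal{T}_q(n,k,1)=\frac{q^{n-k+1}-1}{q-1}.$$
   Context: $\mathcal{G}_q(n,k)$ denotes the set of all $k$-dimensional subspaces of $\mathbb{F}_q^n$. For $0\le r\le k\le n$, a $q$-Turán design $T_q[n,k,r]$ is a set $\mathbb{S}\subseteq\mathcal{G}_q(n,r)$ such that each element of $\mathcal{G}_q(n,k)$ contains at least one element of $\mathbb{S}$. The $q$-Turán number $\mathcal{T}_q(n,k,r)$ is the minimum size of a $q$-Turán design $T_q[n,k,r]$. *)

theory Defs
  imports "HOL-Analysis.Cartesian_Space" "HOL-Number_Theory.Prime_Powers"
begin

definition grassmannian :: "nat \<Rightarrow> ('a::field ^ 'n::finite) set set" where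
  "grassmannian k = {U. vec.subspace U \<and> vec.dim U = k}"

definition turan_design :: "nat \<Rightarrow> nat \<Rightarrow> ('a::field ^ 'n::finite) set set \<Rightarrow> bool" where
  "turan_design k r S \<longleftrightarrow>
     S \<subseteq> grassmannian r \<and> (\<forall>U\<in>grassmannian k. \<exists>W\<in>S. W \<subseteq> U)"

text \<open>
  The field \<open>'a\<close> is the finite field with \<open>q = CARD('a)\<close> elements and \<open>n = CARD('n)\<close>.
  Every design is then finite, so \<open>card\<close> is its true size; for \<open>r \<le> k \<le> n\<close>, the only
  case in which the number is meaningful, the set of all \<open>r\<close>-subspaces is a design.
\<close>

definition turan_number :: "('a::{field,finite} ^ 'n::finite) itself \<Rightarrow> nat \<Rightarrow> nat \<Rightarrow> nat" where
  "turan_number _ k r = (LEAST m. \<exists>S :: ('a ^ 'n) set set. turan_design k r S \<and> card S = m)"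

end

theory Submission imports Defs
begin

text \<open>
  Call the one-dimensional subspaces points. A \<open>q\<close>-Turan design with \<open>r = 1\<close> is a set of points
  of which every \<open>k\<close>-dimensional subspace contains at least one, and the claim is that the cheapest way to block all of
  them is to take every point of a subspace \<open>W\<close> of dimension \<open>n - k + 1\<close>.

  Such a \<open>W\<close> does block: by the dimension formula it meets each \<open>k\<close>-dimensional subspace
  in more than the zero vector (\<open>turan_design_points_of_subspace\<close>). Its points partition its
  \<open>q ^ (n - k + 1) - 1\<close> nonzero vectors into classes of \<open>q - 1\<close> vectors each
  (\<open>card_points_of_subspace\<close>), which gives the number in the claim.

  Conversely, a smaller set \<open>S\<close> of points misses some \<open>k\<close>-dimensional subspace, which can be
  built greedily one dimension at a time (\<open>exists_subspace_avoiding_points\<close>). Suppose that \<open>U\<close>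
  has dimension \<open>j < k\<close> and contains no point of \<open>S\<close>. Enlarging \<open>U\<close> by a vector \<open>v\<close> outside \<open>U\<close>
  brings in a point \<open>P\<close> of \<open>S\<close> only when \<open>v\<close> lies in \<open>U + P\<close>, and \<open>U + P\<close> has just
  \<open>q ^ (j + 1) - q ^ j\<close> vectors outside \<open>U\<close>. All points of \<open>S\<close> together therefore forbid at
  most \<open>card S * (q - 1) * q ^ j\<close> of the \<open>q ^ n - q ^ j\<close> vectors outside \<open>U\<close>, and this is too few
  as long as \<open>card S * (q - 1) < q ^ (n - j) - 1\<close>. The bound is tightest in the last step,
  \<open>j = k - 1\<close>, where it is exactly the number of nonzero vectors of \<open>W\<close>.
\<close>

section \<open>Counting vectors and points\<close>

text \<open>
  A vector of the larger span is a unique combination of \<open>b\<close> and a vector of the smaller one.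
\<close>

lemma card_span_insert:
  fixes b :: "'a::{field,finite} ^ 'n::finite"
  assumes b: "b \<notin> vec.span B"
  shows "card (vec.span (insert b B)) = CARD('a) * card (vec.span B)"
proof -
  let ?f = "\<lambda>(c, u). c *s b + u"
  have "inj_on ?f (UNIV \<times> vec.span B)"
  proof (rule inj_onI, clarify)
    fix c d u w
    assume uw: "u \<in> vec.span B" "w \<in> vec.span B" and eq: "c *s b + u = d *s b + w"
    have "(c - d) *s b = w - u"
      using eq by (simp add: vec.scale_left_diff_distrib algebra_simps)
    then have "(c - d) *s b \<in> vec.span B"
      using uw by (simp add: vec.span_diff)
    then have "inverse (c - d) *s ((c - d) *s b) \<in> vec.span B"
      by (rule vec.span_scale)
    then have "c = d"
      using b by (cases "c = d") (simp_all add: vec.scale_scale)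
    then show "c = d \<and> u = w" using eq by simp
  qed
  moreover have "?f ` (UNIV \<times> vec.span B) = vec.span (insert b B)"
  proof (intro equalityI subsetI)
    fix x assume "x \<in> ?f ` (UNIV \<times> vec.span B)"
    then obtain c u where "x = c *s b + u" "u \<in> vec.span B" by auto
    then have "x - c *s b \<in> vec.span B" by simp
    then show "x \<in> vec.span (insert b B)"
      unfolding vec.span_breakdown_eq by blast
  next
    fix x assume "x \<in> vec.span (insert b B)"
    then obtain c where "x - c *s b \<in> vec.span B"
      by (auto simp: vec.span_breakdown_eq)
    then show "x \<in> ?f ` (UNIV \<times> vec.span B)"
      by (intro image_eqI[where x = "(c, x - c *s b)"]) auto
  qed
  ultimately show ?thesis
    using card_image by (fastforce simp: card_cartesian_product)
qed

lemma card_subspace: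
  fixes U :: "('a::{field,finite} ^ 'n::finite) set"
  assumes U: "vec.subspace U"
  shows "card U = CARD('a) ^ vec.dim U"
proof -
  have card_span: "vec.independent B \<Longrightarrow> card (vec.span B) = CARD('a) ^ card B"
    for B :: "('a ^ 'n) set"
  proof (induction B rule: infinite_finite_induct)
    case (insert b B)
    then show ?case
      by (simp add: vec.independent_insert card_span_insert)
  qed auto
  obtain B where B: "B \<subseteq> U" "vec.independent B" "U \<subseteq> vec.span B" "card B = vec.dim U"
    by (rule vec.basis_exists)
  then have "vec.span B = U"
    using vec.span_subspace[OF _ _ U] by blast
  then show ?thesis using card_span[OF B(2)] B(4) by simp
qed

lemma field_card_ge_2: "2 \<le> CARD('a::{field,finite})"
proof -
  have "card {0, 1 :: 'a} \<le> CARD('a)" by (rule card_mono) auto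
  then show ?thesis by simp
qed

lemma span_singleton_point:
  assumes "p \<noteq> (0 :: 'a::field ^ 'n::finite)"
  shows "vec.span {p} \<in> grassmannian 1"
  using assms by (simp add: grassmannian_def del: One_nat_def)

lemma point_eq_span:
  assumes P: "P \<in> grassmannian 1" and p: "p \<in> P" "p \<noteq> (0 :: 'a::field ^ 'n::finite)"
  shows "P = vec.span {p}"
proof -
  have "vec.span {p} \<subseteq> P"
    using P p by (simp add: grassmannian_def vec.span_minimal)
  then show ?thesis
    using P p vec.subspace_dim_equal[of "vec.span {p}" P]
    by (simp add: grassmannian_def)
qed

lemma point_obtain_generator:
  fixes P :: "('a::field ^ 'n::finite) set"
  assumes P: "P \<in> grassmannian 1"
  obtains p where "p \<in> P" "p \<noteq> 0" "P = vec.span {p}"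
proof -
  have "\<not> P \<subseteq> {0}"
    using P vec.dim_eq_0[of P] by (auto simp: grassmannian_def)
  then show thesis using that point_eq_span[OF P] by blast
qed

text \<open>
  Each nonzero vector of \<open>W\<close> spans exactly one point, and each point has \<open>q - 1\<close> of them.
\<close>

lemma card_points_of_subspace:
  fixes W :: "('a::{field,finite} ^ 'n::finite) set"
  assumes W: "vec.subspace W"
  shows "card {P \<in> grassmannian 1. P \<subseteq> W} * (CARD('a) - 1) = CARD('a) ^ vec.dim W - 1"
proof -
  let ?Ps = "{P \<in> grassmannian 1. P \<subseteq> W}"
  have "W - {0} = (\<Union>P\<in>?Ps. P - {0})"
  proof (intro equalityI subsetI)
    fix x assume x: "x \<in> W - {0}"
    then have "vec.span {x} \<in> ?Ps"
      using W span_singleton_point[of x] vec.span_minimal[of "{x}" W] by blast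
    then show "x \<in> (\<Union>P\<in>?Ps. P - {0})"
      using x by (auto intro!: vec.span_base)
  qed blast
  then have "card (W - {0}) = card (\<Union>P\<in>?Ps. P - {0})"
    by simp
  also have "\<dots> = (\<Sum>P\<in>?Ps. card (P - {0}))"
    by (rule card_UN_disjoint) (auto dest: point_eq_span simp del: One_nat_def)
  also have "\<dots> = (\<Sum>P\<in>?Ps. CARD('a) - 1)"
    by (rule sum.cong) (auto simp: grassmannian_def card_subspace card_Diff_singleton vec.subspace_0)
  finally show ?thesis
    using W by (simp add: card_subspace vec.subspace_0)
qed

section \<open>The points of a subspace form a design\<close>

lemma turan_design_points_of_subspace:
  fixes W :: "('a::field ^ 'n::finite) set"
  assumes W: "vec.subspace W" and dim: "CARD('n) < vec.dim W + k"
  shows "turan_design k 1 {P \<in> grassmannian 1. P \<subseteq> W}"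
  unfolding turan_design_def
proof (intro conjI ballI)
  fix U :: "('a ^ 'n) set"
  assume U: "U \<in> grassmannian k"
  have "vec.dim {x + y |x y. x \<in> U \<and> y \<in> W} + vec.dim (U \<inter> W) = k + vec.dim W"
    using U W vec.dim_sums_Int[of U W] by (simp add: grassmannian_def)
  moreover have "vec.dim {x + y |x y. x \<in> U \<and> y \<in> W} \<le> CARD('n)"
    by (rule dim_subset_UNIV_cart_gen)
  ultimately have "vec.dim (U \<inter> W) \<noteq> 0" using dim by linarith
  then obtain p where p: "p \<in> U" "p \<in> W" "p \<noteq> 0" by auto
  then have "vec.span {p} \<subseteq> U" "vec.span {p} \<subseteq> W"
    using U W by (auto simp: grassmannian_def dest: subsetD[OF vec.span_minimal, rotated 2])
  then show "\<exists>P\<in>{P \<in> grassmannian 1. P \<subseteq> W}. P \<subseteq> U"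
    using span_singleton_point[OF p(3)] by blast
qed blast

section \<open>Every design is at least as large\<close>

text \<open>
  An exchange argument: a vector of \<open>P\<close> in the enlarged space involves \<open>v\<close> with a nonzero
  coefficient, so it can be solved for \<open>v\<close>.
\<close>

lemma point_in_extension:
  fixes U :: "('a::field ^ 'n::finite) set"
  assumes U: "vec.subspace U" and p: "p \<notin> U" "p \<in> vec.span (insert v U)"
  shows "v \<in> vec.span (insert p U)"
  using vec.in_span_insert[of p v U] p vec.span_eq_iff[THEN iffD2, OF U] by auto

text \<open>
  The single step of the greedy construction. The union of the spaces \<open>U + P\<close> cannot
  cover the whole space, because each adds only \<open>(q - 1) * q ^ j\<close> vectors to \<open>U\<close>.
\<close>

lemma exists_extension_avoiding_points:
  fixes S :: "('a::{field,finite} ^ 'n::finite) set set"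
  assumes S: "S \<subseteq> grassmannian 1"
    and U: "U \<in> grassmannian j" "\<forall>P\<in>S. \<not> P \<subseteq> U"
    and j: "j \<le> CARD('n)"
    and small: "card S * (CARD('a) - 1) < CARD('a) ^ (CARD('n) - j) - 1"
  obtains V where "V \<in> grassmannian (Suc j)" "\<forall>P\<in>S. \<not> P \<subseteq> V"
proof -
  let ?q = "CARD('a)"
  let ?F = "\<lambda>P. vec.span (P \<union> U) - U"
  have subU: "vec.subspace U" and dimU: "vec.dim U = j"
    using U(1) by (auto simp: grassmannian_def)
  have spanU: "vec.span U = U" using subU by simp
  have cardU: "card U = ?q ^ j" using card_subspace[OF subU] dimU by simp
  have gen: "\<exists>p. p \<notin> U \<and> P = vec.span {p} \<and> vec.span (P \<union> U) = vec.span (insert p U)"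
    if P: "P \<in> S" for P
  proof -
    obtain p where p: "P = vec.span {p}"
      using point_obtain_generator[of P] S P by blast
    have "p \<notin> U"
      using U(2) P p subU by (auto dest: subsetD[OF vec.span_minimal, rotated 2])
    moreover have "vec.span (P \<union> U) = vec.span (insert p U)"
    proof (rule vec.span_eq[THEN iffD2], intro conjI)
      have "p \<in> vec.span (P \<union> U)"
        unfolding p by (simp add: vec.span_base)
      then show "insert p U \<subseteq> vec.span (P \<union> U)"
        by (auto intro: vec.span_base)
      have "P \<subseteq> vec.span (insert p U)"
        unfolding p by (rule vec.span_mono) auto
      then show "P \<union> U \<subseteq> vec.span (insert p U)"
        by (auto intro: vec.span_base)
    qed
    ultimately show ?thesis using p by blast
  qed
  have cardF: "card (?F P) = (?q - 1) * ?q ^ j" if P: "P \<in> S" for P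
  proof -
    obtain p where p: "p \<notin> U" "vec.span (P \<union> U) = vec.span (insert p U)"
      using gen[OF P] by blast
    have "card (vec.span (insert p U)) = ?q * ?q ^ j"
      using card_span_insert[of p U] p spanU cardU by simp
    moreover have "U \<subseteq> vec.span (insert p U)" by (auto intro: vec.span_base)
    ultimately show ?thesis
      using p(2) cardU by (simp add: card_Diff_subset diff_mult_distrib)
  qed
  have "card (\<Union>P\<in>S. ?F P) \<le> (\<Sum>P\<in>S. card (?F P))"
    by (rule card_UN_le) simp
  also have "\<dots> = card S * (?q - 1) * ?q ^ j"
    using cardF by simp
  also have "\<dots> < (?q ^ (CARD('n) - j) - 1) * ?q ^ j"
    using small by simp
  also have "\<dots> = card (UNIV - U)"
    using j by (simp add: card_Diff_subset cardU diff_mult_distrib flip: power_add)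
  finally have less: "card (\<Union>P\<in>S. ?F P) < card (UNIV - U)" .
  have "\<not> UNIV - U \<subseteq> (\<Union>P\<in>S. ?F P)"
    using less card_mono[of "\<Union>P\<in>S. ?F P" "UNIV - U"] by auto
  then obtain v where v: "v \<notin> U" "\<And>P. P \<in> S \<Longrightarrow> v \<notin> vec.span (P \<union> U)" by blast
  show thesis
  proof (rule that)
    show "vec.span (insert v U) \<in> grassmannian (Suc j)"
      using v(1) dimU unfolding grassmannian_def
      by (simp add: vec.dim_insert vec.span_eq_iff[THEN iffD2, OF subU])
    show "\<forall>P\<in>S. \<not> P \<subseteq> vec.span (insert v U)"
    proof (intro ballI notI)
      fix P assume P: "P \<in> S" and sub: "P \<subseteq> vec.span (insert v U)"
      obtain p where p: "p \<notin> U" "P = vec.span {p}" "vec.span (P \<union> U) = vec.span (insert p U)"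
        using gen[OF P] by blast
      have "p \<in> vec.span (insert v U)"
        using sub p(2) by (auto intro: vec.span_base)
      then show False
        using point_in_extension[OF subU p(1)] v(2)[OF P] p(3) by simp
    qed
  qed
qed

lemma exists_subspace_avoiding_points:
  fixes S :: "('a::{field,finite} ^ 'n::finite) set set"
  assumes S: "S \<subseteq> grassmannian 1" and k: "1 \<le> k" "k \<le> CARD('n)"
    and small: "card S * (CARD('a) - 1) < CARD('a) ^ (CARD('n) - k + 1) - 1"
  obtains U where "U \<in> grassmannian k" "\<forall>P\<in>S. \<not> P \<subseteq> U"
proof -
  have "\<exists>U\<in>grassmannian j. \<forall>P\<in>S. \<not> P \<subseteq> U" if "j \<le> k" for j
    using that
  proof (induction j)
    case 0
    have "\<not> P \<subseteq> {0}" if "P \<in> S" for P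
    proof -
      have "P \<in> grassmannian 1" using that S by blast
      then obtain p where "p \<in> P" "p \<noteq> 0" by (rule point_obtain_generator)
      then show ?thesis by auto
    qed
    moreover have "{0} \<in> grassmannian 0"
      by (simp add: grassmannian_def vec.subspace_single_0)
    ultimately show ?case by (intro bexI[where x = "{0}"] ballI)
  next
    case (Suc j)
    then have "\<exists>U\<in>grassmannian j. \<forall>P\<in>S. \<not> P \<subseteq> U" by simp
    then obtain U where U: "U \<in> grassmannian j" "\<forall>P\<in>S. \<not> P \<subseteq> U" by (elim bexE)
    have "CARD('a) ^ (CARD('n) - k + 1) \<le> CARD('a) ^ (CARD('n) - j)"
      using Suc.prems k by (intro power_increasing) auto
    then have "card S * (CARD('a) - 1) < CARD('a) ^ (CARD('n) - j) - 1"
      using small by linarith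
    moreover have "j \<le> CARD('n)" using Suc.prems k(2) by simp
    ultimately obtain V where "V \<in> grassmannian (Suc j)" "\<forall>P\<in>S. \<not> P \<subseteq> V"
      using exists_extension_avoiding_points[OF S U] by metis
    then show ?case by (intro bexI[where x = V])
  qed
  from this[OF order_refl] show thesis by (elim bexE) (rule that)
qed

theorem theorem7:
  fixes q n k :: nat
  assumes "primepow q"
    and "CARD('a::{field,finite}) = q"
    and "CARD('n::finite) = n"
    and "1 \<le> k" and "k \<le> n"
  shows "real (turan_number TYPE('a ^ 'n) k 1) = (real q ^ (n - k + 1) - 1) / (real q - 1)"
proof -
  have q: "2 \<le> q" using field_card_ge_2[where 'a = 'a] assms(2) by simp
  have "n - k + 1 \<le> CARD('n)" using assms(3-5) by simp
  then obtain d :: "'n set" where d: "card d = n - k + 1"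
    by (rule obtain_subset_with_card_n)
  define W :: "('a ^ 'n) set" where "W = {x. \<forall>i. i \<notin> d \<longrightarrow> x $ i = 0}"
  have W: "vec.subspace W" "vec.dim W = n - k + 1"
    using d unfolding W_def by (auto simp: vec.subspace_def dim_substandard_cart)
  let ?D = "{P \<in> grassmannian 1. P \<subseteq> W}"
  have D: "turan_design k 1 ?D"
    using W assms(3,5) by (intro turan_design_points_of_subspace) auto
  have cardD: "card ?D * (q - 1) = q ^ (n - k + 1) - 1"
    using card_points_of_subspace[OF W(1)] W(2) assms(2) by simp
  have minimal: "card ?D \<le> card S" if S: "turan_design k 1 S" for S :: "('a ^ 'n) set set"
  proof (rule ccontr)
    assume "\<not> card ?D \<le> card S"
    then have "card S * (q - 1) < q ^ (n - k + 1) - 1"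
      using q unfolding cardD[symmetric] by simp
    then obtain U where "U \<in> grassmannian k" "\<forall>P\<in>S. \<not> P \<subseteq> U"
      using exists_subspace_avoiding_points[of S k] S assms(2-5)
      by (auto simp: turan_design_def)
    then show False using S by (auto simp: turan_design_def)
  qed
  have "turan_number TYPE('a ^ 'n) k 1 = card ?D"
    unfolding turan_number_def using D minimal by (intro Least_equality) auto
  moreover have "real (card ?D) * (real q - 1) = real q ^ (n - k + 1) - 1"
    using arg_cong[OF cardD, of real] q by (simp add: of_nat_diff)
  ultimately show ?thesis using q by (simp add: field_simps)
qed

end
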